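(* For all integers $r\ge 0$ and $s\ge 1$, $$\zeta^{\star}(r+2,\underbrace{2,\ldots,2}_{s-1}) = \sum_{i=0}^{r}(-1)^{r-i}2^{i+1}\sum_{\substack{k_1+\cdots+k_{i+1}=r+1\\ k_j\in\mathbb{Z}_{\ge 1}}}\zeta_{-}^{\star}(k_1,\ldots,k_i,k_{i+1}+2s-1),$$ where the inner sum runs over all $(i+1)$-tuples $(k_1,\ldots,k_{i+1})$ of positive integers with sum $r+1$.
   Context: For integers $k_1,\ldots,k_n\ge 1$ with $k_n\ge 2$, the multiple zeta-star value is $$\zeta^{\star}(k_1,\ldots,k_n) := \sum_{0<m_1\le\cdots\le m_n}\frac{1}{m_1^{k_1}\cdots m_n^{k_n}}.$$ For integers $k_1,\ldots,k_n\ge 1$, the alternating multiple series is $$\zeta_{-}^{\star}(k_1,\ldots,k_n) := \sum_{0<m_1\le\cdots\le m_n}\frac{(-1)^{m_n-1}}{m_1^{k_1}\cdots m_n^{k_n}}.$$ An underbrace with number $j$ means that the entry is repeated $j$ times (so for $s=1$ the left-hand side is $\zeta^{\star}(r+2)$). For $i=0$ the term $\zeta_{-}^{\star}(k_1,\ldots,k_i,k_{i+1}+2s-1)$ means $\zeta_{-}^{\star}(k_1+2s-1)$. *)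

theory Defs
  imports Complex_Main
begin

definition star_tuples :: "nat \<Rightarrow> nat \<Rightarrow> nat list set" where
  "star_tuples n N = {ms. length ms = n \<and> sorted ms \<and> set ms \<subseteq> {1..N}}"

(* Both series are limits of the partial sums over 0 < m_1 \<le> ... \<le> m_n \<le> N. For zeta_star, whose
   terms are nonnegative, this is the unordered sum; for zeta_star_alt the order matters, since
   the series is only conditionally convergent when k_n = 1. *)

definition zeta_star :: "nat list \<Rightarrow> real" where
  "zeta_star ks =
     lim (\<lambda>N. \<Sum>ms\<in>star_tuples (length ks) N.
                1 / (\<Prod>j<length ks. real (ms ! j) ^ (ks ! j)))"

definition zeta_star_alt :: "nat list \<Rightarrow> real" where
  "zeta_star_alt ks =
     lim (\<lambda>N. \<Sum>ms\<in>star_tuples (length ks) N.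
                (-1) ^ (last ms - 1) / (\<Prod>j<length ks. real (ms ! j) ^ (ks ! j)))"

definition compositions :: "nat \<Rightarrow> nat \<Rightarrow> nat list set" where
  "compositions n w = {ks. length ks = n \<and> (\<forall>k\<in>set ks. 1 \<le> k) \<and> sum_list ks = w}"

end

(* Encode r by a formal variable y. For fixed m_(i+1) = n, summing the right-hand side over all
   compositions gives 2 y / (n - y) * prod_{m<n} (m + y) / (m - y), whose y-coefficients therefore
   satisfy a two-term recursion in n. The partial fraction expansion in x of
   prod_{m<=j<=N} 1 / (1 - x^2 / j^2) turns the sum on the left-hand side, truncated at N, exactly
   into the right-hand side with weights N!^2 / ((N - n)! (N + n)!) attached to the terms n <= N.
   Here this finite identity is proved by induction on s and N instead; it makes sense even for
   s = 0, where the weighted sum telescopes. Since the weights lie in [0, 1] and tend to 1, and the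
   exponent of n is at least 2, Tannery's theorem lets N tend to infinity. *)

theory Submission
  imports Defs "HOL-Analysis.Analysis" "HOL-Real_Asymp.Real_Asymp"
begin

section \<open>Truncated star sums\<close>

definition star_sum :: "nat list \<Rightarrow> nat \<Rightarrow> real" where
  "star_sum ks N =
     (\<Sum>ms\<in>star_tuples (length ks) N. 1 / (\<Prod>j<length ks. real (ms ! j) ^ (ks ! j)))"

lemma finite_star_tuples: "finite (star_tuples n N)"
  by (rule finite_subset[OF _ finite_lists_length_eq[of "{1..N}" n]])
     (auto simp: star_tuples_def)

lemma star_tuples_0: "star_tuples 0 N = {[]}"
  by (auto simp: star_tuples_def)

text \<open>Sortedness bounds all earlier entries by the last entry \<open>m\<close>, so
  \<open>m\<close> replaces \<open>N\<close> as the bound for the shorter tuple.\<close>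

lemma snoc_mem_star_tuples:
  "ms @ [m] \<in> star_tuples (Suc n) N \<longleftrightarrow> ms \<in> star_tuples n m \<and> m \<in> {1..N}"
  by (auto simp: star_tuples_def sorted_append dest: order_trans)

lemma star_tuples_Suc:
  "star_tuples (Suc n) N = (\<Union>m\<in>{1..N}. (\<lambda>ms. ms @ [m]) ` star_tuples n m)"
proof (intro equalityI subsetI)
  fix ms assume ms: "ms \<in> star_tuples (Suc n) N"
  then have "ms \<noteq> []" by (auto simp: star_tuples_def)
  then obtain ms' m where eq: "ms = ms' @ [m]" by (metis append_butlast_last_id)
  with ms have "ms' \<in> star_tuples n m" "m \<in> {1..N}" by (simp_all only: snoc_mem_star_tuples)
  with eq show "ms \<in> (\<Union>m\<in>{1..N}. (\<lambda>ms. ms @ [m]) ` star_tuples n m)" by blast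
next
  fix ms assume "ms \<in> (\<Union>m\<in>{1..N}. (\<lambda>ms. ms @ [m]) ` star_tuples n m)"
  then show "ms \<in> star_tuples (Suc n) N"
    by (elim UN_E imageE) (simp only: snoc_mem_star_tuples)
qed

lemma sum_star_tuples_Suc:
  "(\<Sum>ms\<in>star_tuples (Suc n) N. g ms) =
     (\<Sum>m=1..N. \<Sum>ms\<in>star_tuples n m. g (ms @ [m]))"
proof -
  have "(\<Sum>ms\<in>star_tuples (Suc n) N. g ms) =
      (\<Sum>m=1..N. \<Sum>ms\<in>(\<lambda>ms. ms @ [m]) ` star_tuples n m. g ms)"
    unfolding star_tuples_Suc
    by (rule sum.UNION_disjoint) (auto simp: finite_star_tuples)
  also have "\<dots> = (\<Sum>m=1..N. \<Sum>ms\<in>star_tuples n m. g (ms @ [m]))"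
    by (rule sum.cong[OF refl]) (subst sum.reindex, auto simp: inj_on_def)
  finally show ?thesis .
qed

lemma prod_nth_snoc:
  assumes "length ms = length ks"
  shows "(\<Prod>j<length (ks @ [k]). real ((ms @ [m]) ! j) ^ ((ks @ [k]) ! j)) =
    (\<Prod>j<length ks. real (ms ! j) ^ (ks ! j)) * real m ^ k"
  using assms by (simp add: nth_append)

lemma star_sum_Nil: "star_sum [] N = 1"
  by (simp add: star_sum_def star_tuples_0)

lemma star_sum_snoc: "star_sum (ks @ [k]) N = (\<Sum>m=1..N. star_sum ks m / real m ^ k)"
proof -
  have "star_sum (ks @ [k]) N = (\<Sum>m=1..N. \<Sum>ms\<in>star_tuples (length ks) m.
      1 / (\<Prod>j<length (ks @ [k]). real ((ms @ [m]) ! j) ^ ((ks @ [k]) ! j)))"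
    unfolding star_sum_def by (simp only: length_append_singleton sum_star_tuples_Suc)
  also have "\<dots> = (\<Sum>m=1..N. star_sum ks m / real m ^ k)"
    unfolding star_sum_def sum_divide_distrib
    by (intro sum.cong refl, subst prod_nth_snoc) (auto simp: star_tuples_def)
  finally show ?thesis .
qed

text \<open>The sign depends on the largest variable only, so fixing that variable leaves a
  non-alternating star sum inside.\<close>

lemma star_sum_alt_snoc:
  "(\<Sum>ms\<in>star_tuples (length (ks @ [k])) N.
      (-1) ^ (last ms - 1) / (\<Prod>j<length (ks @ [k]). real (ms ! j) ^ ((ks @ [k]) ! j))) =
   (\<Sum>m=1..N. (-1) ^ (m - 1) * (star_sum ks m / real m ^ k))"
proof -
  have "(\<Sum>ms\<in>star_tuples (length (ks @ [k])) N.
      (-1) ^ (last ms - 1) / (\<Prod>j<length (ks @ [k]). real (ms ! j) ^ ((ks @ [k]) ! j))) =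
    (\<Sum>m=1..N. \<Sum>ms\<in>star_tuples (length ks) m. (-1) ^ (last (ms @ [m]) - 1) /
       (\<Prod>j<length (ks @ [k]). real ((ms @ [m]) ! j) ^ ((ks @ [k]) ! j)))"
    by (simp only: length_append_singleton sum_star_tuples_Suc)
  also have "\<dots> = (\<Sum>m=1..N. (-1) ^ (m - 1) * (star_sum ks m / real m ^ k))"
    unfolding star_sum_def sum_divide_distrib sum_distrib_left
    by (intro sum.cong refl, subst prod_nth_snoc) (auto simp: star_tuples_def)
  finally show ?thesis .
qed

lemma star_sum_nonneg: "0 \<le> star_sum ks N"
  by (auto simp: star_sum_def intro!: sum_nonneg prod_nonneg)

section \<open>Growth of truncated star sums and absolute convergence\<close>

lemma sum_inverse_sqrt_le: "(\<Sum>m=1..n. 1 / sqrt (real m)) \<le> 2 * sqrt (real n)"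
proof (induction n)
  case (Suc n)
  let ?a = "sqrt (real n)" and ?b = "sqrt (real (Suc n))"
  \<comment> \<open>AM-GM for sqrt n and sqrt (n + 1); it yields 1 / sqrt (n + 1) \<le> 2 (sqrt (n +
    1) - sqrt n), whose right-hand side telescopes.\<close>
  have "?a * ?b \<le> real n + 1/2"
    using sum_squares_bound[of ?a ?b] by simp
  moreover have "?b * ?b = real n + 1" by simp
  ultimately have "1 \<le> (2 * ?b - 2 * ?a) * ?b" by (simp add: algebra_simps)
  then have "1 / ?b \<le> 2 * ?b - 2 * ?a" by (simp add: divide_le_eq)
  with Suc show ?case by simp
qed simp

text \<open>A square-root bound reproduces itself under appending an exponent: sqrt m / m = 1 / sqrt
  m, and these sum to at most 2 sqrt n. Any growth exponent below 1 would do for convergence against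
  1 / n^2.\<close>

lemma star_sum_le_sqrt:
  assumes "\<forall>k\<in>set ks. 1 \<le> k" "1 \<le> n"
  shows "star_sum ks n \<le> 2 ^ length ks * sqrt (real n)"
  using assms
proof (induction ks arbitrary: n rule: rev_induct)
  case Nil
  then show ?case by (simp add: star_sum_Nil)
next
  case (snoc k ks)
  have "star_sum (ks @ [k]) n \<le> (\<Sum>m=1..n. 2 ^ length ks * (1 / sqrt (real m)))"
    unfolding star_sum_snoc
  proof (rule sum_mono)
    fix m assume m: "m \<in> {1..n}"
    have "real m \<le> real m ^ k"
      using m snoc.prems(1) by (intro self_le_power) auto
    then have "star_sum ks m / real m ^ k \<le> (2 ^ length ks * sqrt (real m)) / real m"
      using m snoc by (intro frac_le) (auto simp: star_sum_nonneg)
    also have "\<dots> = 2 ^ length ks * (sqrt (real m) / real m)" by simp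
    also have "sqrt (real m) / real m = 1 / sqrt (real m)"
      using m by (simp add: field_simps)
    finally show "star_sum ks m / real m ^ k \<le> 2 ^ length ks * (1 / sqrt (real m))" .
  qed
  also have "\<dots> \<le> 2 ^ length ks * (2 * sqrt (real n))"
    unfolding sum_distrib_left[symmetric]
    by (intro mult_left_mono sum_inverse_sqrt_le) auto
  finally show ?case by simp
qed

lemma summable_star_sum_div_power:
  assumes "\<forall>k\<in>set ks. 1 \<le> k" "2 \<le> k"
  shows "summable (\<lambda>n. star_sum ks n / real n ^ k)"
proof (rule summable_comparison_test')
  show "summable (\<lambda>n. 2 ^ length ks * real n powr (-(3/2)))"
    by (intro summable_mult) (simp add: summable_real_powr_iff)
next
  fix n :: nat assume n: "1 \<le> n"
  have "real n ^ 2 \<le> real n ^ k"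
    using n assms by (intro power_increasing) auto
  then have "star_sum ks n / real n ^ k \<le> (2 ^ length ks * sqrt (real n)) / real n ^ 2"
    using n assms star_sum_le_sqrt by (intro frac_le) (auto simp: star_sum_nonneg)
  also have "\<dots> = 2 ^ length ks * (real n powr (1/2) / real n powr 2)"
    using n by (simp add: powr_half_sqrt)
  also have "real n powr (1/2) / real n powr 2 = real n powr (-(3/2))"
    by (subst powr_diff[symmetric]) simp
  finally show "norm (star_sum ks n / real n ^ k) \<le> 2 ^ length ks * real n powr (-(3/2))"
    by (simp add: star_sum_nonneg)
qed

section \<open>Signed sums over compositions\<close>

lemma finite_compositions: "finite (compositions n w)"
  by (rule finite_subset[OF _ finite_lists_length_eq[of "{..w}" n]])
     (auto simp: compositions_def member_le_sum_list)

lemma compositions_0: "compositions 0 w = (if w = 0 then {[]} else {})"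
  by (auto simp: compositions_def)

lemma compositions_eq_empty: "w < n \<Longrightarrow> compositions n w = {}"
proof -
  have "length ks \<le> sum_list ks" if "\<forall>k\<in>set ks. 1 \<le> k" for ks :: "nat list"
    using that by (induction ks) auto
  then show "w < n \<Longrightarrow> compositions n w = {}"
    by (fastforce simp: compositions_def)
qed

lemma composition_SucE:
  assumes "ks \<in> compositions (Suc i) w"
  obtains ks' k where "ks = ks' @ [k]" "length ks' = i" "\<forall>j\<in>set ks'. 1 \<le> j" "1 \<le> k"
    "sum_list ks' + k = w"
proof -
  from assms have "ks \<noteq> []" by (auto simp: compositions_def)
  then obtain ks' k where "ks = ks' @ [k]" by (metis append_butlast_last_id)
  with assms show ?thesis by (intro that) (auto simp: compositions_def)
qed

text \<open>A composition either ends in 1, or arises by raising the last part of a composition of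
  \<open>w\<close> with equally many parts.\<close>

lemma sum_compositions_Suc_Suc:
  "(\<Sum>ks\<in>compositions (Suc i) (Suc w). f ks) =
     (\<Sum>ks\<in>compositions i w. f (ks @ [1])) +
     (\<Sum>ks\<in>compositions (Suc i) w. f (butlast ks @ [Suc (last ks)]))"
proof -
  let ?g = "\<lambda>ks :: nat list. ks @ [1]" and ?h = "\<lambda>ks. butlast ks @ [Suc (last ks)]"
  have eq: "compositions (Suc i) (Suc w) = ?g ` compositions i w \<union> ?h ` compositions (Suc i) w"
  proof (intro equalityI subsetI)
    fix ks assume "ks \<in> compositions (Suc i) (Suc w)"
    then obtain ks' k where ks: "ks = ks' @ [k]" "length ks' = i" "\<forall>j\<in>set ks'. 1 \<le> j" "1 \<le> k"
      "sum_list ks' + k = Suc w" by (rule composition_SucE)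
    show "ks \<in> ?g ` compositions i w \<union> ?h ` compositions (Suc i) w"
    proof (cases "k = 1")
      case True
      with ks show ?thesis by (auto simp: compositions_def)
    next
      case False
      then have "ks = ?h (ks' @ [k - 1])" "ks' @ [k - 1] \<in> compositions (Suc i) w"
        using ks by (auto simp: compositions_def)
      then show ?thesis by blast
    qed
  next
    fix ks assume "ks \<in> ?g ` compositions i w \<union> ?h ` compositions (Suc i) w"
    then show "ks \<in> compositions (Suc i) (Suc w)"
    proof
      assume "ks \<in> ?h ` compositions (Suc i) w"
      then show ?thesis
        by (elim imageE composition_SucE) (auto simp: compositions_def)
    qed (auto simp: compositions_def)
  qed
  have inj: "inj_on ?h (compositions (Suc i) w)"
    by (rule inj_onI, elim composition_SucE) auto
  have "?g ks \<noteq> ?h ks'" if "ks' \<in> compositions (Suc i) w" for ks ks'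
    using that by (elim composition_SucE) auto
  then have disj: "?g ` compositions i w \<inter> ?h ` compositions (Suc i) w = {}" by fast
  have "inj_on ?g (compositions i w)" by (simp add: inj_on_def)
  with inj have reindex: "sum f (?g ` compositions i w) = (\<Sum>ks\<in>compositions i w. f (?g ks))"
    "sum f (?h ` compositions (Suc i) w) = (\<Sum>ks\<in>compositions (Suc i) w. f (?h ks))"
    by (simp_all only: sum.reindex o_def)
  show ?thesis
    unfolding eq reindex[symmetric]
    using disj by (intro sum.union_disjoint) (simp_all add: finite_compositions)
qed

text \<open>The generating function of star_coeff w n in w is the product of (m + y) / (m - y) over
  1 \<le> m \<le> n, because a factor 1 / m^k, summed over k with weight 2 (-1)^(k - 1) y^k, gives
  2 y / (m + y); star_incr v n is the coefficient of y^(v + 1) in its n-th increment.\<close>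

definition star_coeff :: "nat \<Rightarrow> nat \<Rightarrow> real" where
  "star_coeff w n =
     (\<Sum>i=0..w. (-1) ^ (w - i) * 2 ^ i * (\<Sum>ks\<in>compositions i w. star_sum ks n))"

definition star_incr :: "nat \<Rightarrow> nat \<Rightarrow> real" where
  "star_incr v n =
     (\<Sum>i=0..v. (-1) ^ (v - i) * 2 ^ (i + 1) *
        (\<Sum>ks\<in>compositions (i + 1) (v + 1). star_sum (butlast ks) n / real n ^ last ks))"

section \<open>Recursions for the coefficients\<close>

lemma star_coeff_0: "star_coeff 0 n = 1"
  by (simp add: star_coeff_def compositions_0 star_sum_Nil)

text \<open>The empty composition has weight 0, so the term i = 0 drops out and the index shifts;
  the largest summation variable \<open>m\<close> is then moved outermost.\<close>

lemma star_coeff_Suc: "star_coeff (Suc v) n = (\<Sum>m=1..n. star_incr v m)"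
proof -
  have "star_coeff (Suc v) n =
      (\<Sum>i=0..v. (-1) ^ (v - i) * 2 ^ (i + 1) *
        (\<Sum>ks\<in>compositions (i + 1) (v + 1). star_sum ks n))"
    unfolding star_coeff_def sum.atLeast0_atMost_Suc_shift
    by (simp add: compositions_0)
  also have "\<dots> = (\<Sum>i=0..v. (-1) ^ (v - i) * 2 ^ (i + 1) *
        (\<Sum>ks\<in>compositions (i + 1) (v + 1). \<Sum>m=1..n. star_sum (butlast ks) m / real m ^ last ks))"
    by (intro sum.cong refl arg_cong2[where f = times])
       (auto elim!: composition_SucE simp: star_sum_snoc)
  also have "\<dots> = (\<Sum>m=1..n. star_incr v m)"
    unfolding star_incr_def
    by (subst (2) sum.swap, subst sum.swap) (rule sum.cong[OF refl], rule sum_distrib_left)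
  finally show ?thesis .
qed

lemma star_incr_0: "1 \<le> n \<Longrightarrow> real n * star_incr 0 n = 2"
  by (simp add: star_incr_def sum_compositions_Suc_Suc compositions_0 compositions_eq_empty
      star_sum_Nil)

text \<open>Coefficient form of (n + y) (P_n - P_(n-1)) = 2 y P_n, where P_n is the product of (m +
  y) / (m - y) over m \<le> n. Compositions ending in 1 supply \<open>star_coeff\<close>; lowering
  the last part of the others supplies \<open>star_incr v n\<close>.\<close>

lemma star_incr_Suc:
  assumes "1 \<le> n"
  shows "real n * star_incr (Suc v) n + star_incr v n = 2 * star_coeff (Suc v) n"
proof -
  let ?w = "Suc v"
  define T where "T = (\<lambda>i. \<Sum>ks\<in>compositions (Suc i) ?w. star_sum (butlast ks) n / real n ^ last ks)"
  have split: "real n * (\<Sum>ks\<in>compositions (i + 1) (?w + 1). star_sum (butlast ks) n / real n ^ last ks) =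
      (\<Sum>ks\<in>compositions i ?w. star_sum ks n) + T i" for i
    using assms
    by (simp add: sum_compositions_Suc_Suc T_def distrib_left sum_distrib_left)
  have "real n * star_incr ?w n =
      (\<Sum>i=0..?w. (-1) ^ (?w - i) * 2 ^ (i + 1) * (real n *
        (\<Sum>ks\<in>compositions (i + 1) (?w + 1). star_sum (butlast ks) n / real n ^ last ks)))"
    unfolding star_incr_def by (subst sum_distrib_left) (simp only: mult.left_commute)
  also have "\<dots> = 2 * star_coeff ?w n + (\<Sum>i=0..?w. (-1) ^ (?w - i) * 2 ^ (i + 1) * T i)"
    unfolding split star_coeff_def
    by (simp add: distrib_left sum.distrib sum_distrib_left mult_ac)
  also have "(\<Sum>i=0..?w. (-1) ^ (?w - i) * 2 ^ (i + 1) * T i) = - star_incr v n"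
  proof -
    \<comment> \<open>Weight v + 1 cannot be split into v + 2 positive parts. The remaining terms
      carry one sign more than those of \<open>star_incr v n\<close>.\<close>
    have "T ?w = 0" by (simp add: T_def compositions_eq_empty)
    then have "(\<Sum>i=0..?w. (-1) ^ (?w - i) * 2 ^ (i + 1) * T i) =
        (\<Sum>i=0..v. (-1) ^ (?w - i) * 2 ^ (i + 1) * T i)" by simp
    also have "\<dots> = - star_incr v n"
      unfolding star_incr_def T_def sum_negf[symmetric]
      by (intro sum.cong refl) (simp add: Suc_diff_le)
    finally show ?thesis .
  qed
  finally show ?thesis by simp
qed

lemma star_coeff_diff:
  assumes "1 \<le> n"
  shows "star_coeff (Suc v) n - star_coeff (Suc v) (n - 1) = star_incr v n"
  using assms by (cases n) (simp_all add: star_coeff_Suc)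

text \<open>Coefficient form of n (P_n - P_(n-1)) = y (P_n + P_(n-1)), that is, of (n - y) P_n = (n
  + y) P_(n-1).\<close>

lemma real_mult_star_incr:
  assumes "1 \<le> n"
  shows "real n * star_incr v n = star_coeff v n + star_coeff v (n - 1)"
proof (cases v)
  case 0
  with assms show ?thesis by (simp add: star_incr_0 star_coeff_0)
next
  case (Suc u)
  with star_incr_Suc[OF assms, of u] star_coeff_diff[OF assms, of u] show ?thesis by simp
qed

section \<open>The finite identity\<close>

text \<open>For n \<le> N this is N!^2 / ((N - n)! (N + n)!); it vanishes for n > N.\<close>

primrec binom_weight :: "nat \<Rightarrow> nat \<Rightarrow> real" where
  "binom_weight N 0 = 1"
| "binom_weight N (Suc n) = binom_weight N n * (real N - real n) / (real N + real n + 1)"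

lemma binom_weight_eq_0: "N < n \<Longrightarrow> binom_weight N n = 0"
proof (induction n)
  case (Suc n)
  then show ?case by (cases "N = n") auto
qed simp

lemma binom_weight_bounds: "0 \<le> binom_weight N n \<and> binom_weight N n \<le> 1"
proof (induction n)
  case (Suc n)
  \<comment> \<open>Past \<open>N\<close> the factors turn negative, but the factor 0 at n = N has
    already made the weight vanish.\<close>
  show ?case
  proof (cases "N < Suc n")
    case True
    then show ?thesis by (simp only: binom_weight_eq_0) simp
  next
    case False
    then have "0 \<le> (real N - real n) / (real N + real n + 1)"
      "(real N - real n) / (real N + real n + 1) \<le> 1" by (auto simp: divide_simps)
    with Suc show ?thesis
      using mult_le_one[of "binom_weight N n"] by (simp flip: times_divide_eq_right)
  qed
qed simp

lemma binom_weight_tendsto_1: "(\<lambda>N. binom_weight N n) \<longlonglongrightarrow> 1"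
proof (induction n)
  case (Suc n)
  have "(\<lambda>N. (real N - real n) / (real N + real n + 1)) \<longlonglongrightarrow> 1" by real_asymp
  from tendsto_mult[OF Suc this] show ?case by simp
qed simp

text \<open>The quotient of the two factorial expressions is (N + 1)^2 / ((N + 1 - n) (N + 1 + n));
  cleared of denominators, the relation also covers n > N. It drives the induction on
  \<open>N\<close>.\<close>

lemma binom_weight_Suc_left:
  "binom_weight N n * real (Suc N) ^ 2 =
     binom_weight (Suc N) n * (real (Suc N) ^ 2 - real n ^ 2)"
proof (induction n)
  case (Suc n)
  define a where "a = real N"
  define b where "b = real n"
  have nn: "a + b + 1 \<noteq> 0" "a + b + 2 \<noteq> 0"
    unfolding a_def b_def by linarith+
  have IH: "binom_weight N n * (a + 1) ^ 2 = binom_weight (Suc N) n * ((a + 1) ^ 2 - b ^ 2)"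
    using Suc by (simp add: a_def b_def add.commute)
  have "binom_weight N (Suc n) * (a + 1) ^ 2 = binom_weight N n * (a + 1) ^ 2 * (a - b) / (a + b + 1)"
    by (simp add: a_def b_def)
  also have "\<dots> = binom_weight (Suc N) n * (a + 1 - b) * (a - b)"
    unfolding IH using nn by (simp add: field_simps power2_eq_square)
  also have "\<dots> = binom_weight (Suc N) n * (a + 1 - b) / (a + b + 2) * ((a + 1) ^ 2 - (b + 1) ^ 2)"
    using nn by (simp add: field_simps power2_eq_square)
  also have "binom_weight (Suc N) n * (a + 1 - b) / (a + b + 2) = binom_weight (Suc N) (Suc n)"
    by (simp add: a_def b_def algebra_simps)
  finally show ?case by (simp add: a_def b_def add.commute)
qed simp

text \<open>The right-hand side with weights, cut off at \<open>N\<close>. Writing n / n^(2 s)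
  instead of 1 / n^(2 s - 1) keeps the case s = 0 meaningful.\<close>

definition weighted_sum :: "nat \<Rightarrow> nat \<Rightarrow> nat \<Rightarrow> real" where
  "weighted_sum v s N =
     (\<Sum>n=1..N. (-1) ^ (n - 1) * binom_weight N n * real n * star_incr v n / real n ^ (2 * s))"

text \<open>The weight at n times N + n equals the weight at n - 1 times N - (n - 1), so
  neighbouring terms cancel by the alternating sign. For M = N the upper boundary term
  vanishes.\<close>

lemma weighted_sum_telescope:
  "(\<Sum>n=1..M. (-1) ^ (n - 1) * binom_weight N n *
      ((real N - real n) * star_coeff v n + (real N + real n) * star_coeff v (n - 1))) =
    real N * star_coeff v 0 - (-1) ^ M * binom_weight N M * (real N - real M) * star_coeff v M"
proof (induction M)
  case (Suc M)
  have "real N + real M + 1 \<noteq> 0" by linarith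
  then have "binom_weight N (Suc M) * (real N + real (Suc M)) = binom_weight N M * (real N - real M)"
    by (simp add: field_simps)
  then have "(-1) ^ M * (binom_weight N (Suc M) * (real N + real (Suc M))) * star_coeff v M =
      (-1) ^ M * (binom_weight N M * (real N - real M)) * star_coeff v M" by simp
  with Suc show ?case by (simp del: binom_weight.simps add: algebra_simps)
qed simp

text \<open>N times the sum for \<open>Suc v\<close> minus the sum for \<open>v\<close> telescopes
  to N * \<open>star_coeff (Suc v) 0\<close>, which is 0; for v = 0 the telescoping starts from
  \<open>star_coeff 0 0\<close> = 1 instead.\<close>

lemma weighted_sum_0:
  assumes "1 \<le> N"
  shows "weighted_sum v 0 N = 1 / real N ^ v"
proof (induction v)
  case 0
  have "real N * weighted_sum 0 0 N = (\<Sum>n=1..N. (-1) ^ (n - 1) * binom_weight N n *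
      ((real N - real n) * star_coeff 0 n + (real N + real n) * star_coeff 0 (n - 1)))"
    unfolding weighted_sum_def sum_distrib_left
    by (intro sum.cong refl) (simp add: star_incr_0 star_coeff_0 algebra_simps)
  also have "\<dots> = real N"
    by (subst weighted_sum_telescope) (simp add: star_coeff_0)
  finally show ?case using assms by simp
next
  case (Suc v)
  have "real N * weighted_sum (Suc v) 0 N - weighted_sum v 0 N =
    (\<Sum>n=1..N. (-1) ^ (n - 1) * binom_weight N n * (real N * (real n * star_incr (Suc v) n)
        - real n * star_incr v n))"
    unfolding weighted_sum_def sum_distrib_left sum_subtractf[symmetric]
    by (intro sum.cong refl) (simp add: algebra_simps)
  \<comment> \<open>With c = \<open>star_coeff (Suc v)\<close>, the bracket is N (c n + c (n - 1)) -
    n (c n - c (n - 1)).\<close>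
  also have "\<dots> = (\<Sum>n=1..N. (-1) ^ (n - 1) * binom_weight N n *
      ((real N - real n) * star_coeff (Suc v) n + (real N + real n) * star_coeff (Suc v) (n - 1)))"
    by (intro sum.cong refl arg_cong2[where f = times])
       (simp, simp add: real_mult_star_incr star_coeff_diff[of _ v, symmetric], simp add: algebra_simps)
  also have "\<dots> = 0"
    by (subst weighted_sum_telescope) (simp add: star_coeff_Suc)
  finally show ?case using Suc assms by (simp add: field_simps)
qed

text \<open>Passing from N to N + 1 changes the weight by n^2 / (N + 1)^2 times the new weight, and
  the factor n^2 lowers \<open>s\<close> by one.\<close>

lemma weighted_sum_Suc_Suc:
  "weighted_sum v (Suc s) (Suc N) = weighted_sum v (Suc s) N + weighted_sum v s (Suc N) / real (Suc N) ^ 2"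
proof -
  \<comment> \<open>The extra term n = N + 1 has weight 0, so both sums share one range.\<close>
  have ext: "weighted_sum v (Suc s) N = (\<Sum>n=1..Suc N. (-1) ^ (n - 1) * binom_weight N n * real n *
      star_incr v n / real n ^ (2 * Suc s))"
    by (simp add: weighted_sum_def binom_weight_eq_0 del: binom_weight.simps)
  have "binom_weight (Suc N) n / real n ^ (2 * Suc s) = binom_weight N n / real n ^ (2 * Suc s)
      + binom_weight (Suc N) n / real n ^ (2 * s) / real (Suc N) ^ 2" if "1 \<le> n" for n
  proof -
    have "binom_weight N n =
        binom_weight (Suc N) n * (real (Suc N) ^ 2 - real n ^ 2) / real (Suc N) ^ 2"
      using binom_weight_Suc_left[of N n] by (simp add: field_simps)
    also have "\<dots> = binom_weight (Suc N) n - binom_weight (Suc N) n * real n ^ 2 / real (Suc N) ^ 2"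
      by (simp add: diff_divide_distrib right_diff_distrib del: of_nat_Suc)
    finally have e: "binom_weight (Suc N) n =
       binom_weight N n + binom_weight (Suc N) n * real n ^ 2 / real (Suc N) ^ 2" by simp
    have "binom_weight (Suc N) n / real n ^ (2 * Suc s) = binom_weight N n / real n ^ (2 * Suc s)
      + binom_weight (Suc N) n * real n ^ 2 / real (Suc N) ^ 2 / real n ^ (2 * Suc s)"
      by (subst e) (simp add: add_divide_distrib)
    then show ?thesis using that by (simp add: power_add power2_eq_square)
  qed
  note * = this
  show ?thesis
    unfolding ext unfolding weighted_sum_def sum_divide_distrib sum.distrib[symmetric]
  proof (rule sum.cong[OF refl])
    fix n assume n: "n \<in> {1..Suc N}"
    let ?c = "(-1) ^ (n - 1) * real n * star_incr v n"
    from * [of n] n have "?c * (binom_weight (Suc N) n / real n ^ (2 * Suc s)) =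
      ?c * (binom_weight N n / real n ^ (2 * Suc s)
      + binom_weight (Suc N) n / real n ^ (2 * s) / real (Suc N) ^ 2)" by simp
    then show "(-1) ^ (n - 1) * binom_weight (Suc N) n * real n * star_incr v n / real n ^ (2 * Suc s) =
      (-1) ^ (n - 1) * binom_weight N n * real n * star_incr v n / real n ^ (2 * Suc s) +
      (-1) ^ (n - 1) * binom_weight (Suc N) n * real n * star_incr v n / real n ^ (2 * s) / real (Suc N) ^ 2"
      by (simp only: distrib_left times_divide_eq_right mult_ac)
  qed
qed

lemma weighted_sum_Suc:
  "weighted_sum v (Suc s) N = (\<Sum>m=1..N. weighted_sum v s m / real m ^ 2)"
proof (induction N)
  case (Suc N)
  then show ?case by (simp add: weighted_sum_Suc_Suc)
qed (simp add: weighted_sum_def)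

text \<open>Appending an exponent 2 and raising \<open>s\<close> obey the same recursion; in the
  base case the closed form 1 / m^r at s = 0 and the division by m^2 make up the exponent r +
  2.\<close>

lemma star_sum_eq_weighted_sum:
  "star_sum ((r + 2) # replicate s 2) N = weighted_sum r (Suc s) N"
proof (induction s arbitrary: N)
  case 0
  have "star_sum ([] @ [r + 2]) N = weighted_sum r (Suc 0) N"
    unfolding star_sum_snoc weighted_sum_Suc
    by (intro sum.cong refl) (simp add: star_sum_Nil weighted_sum_0 power_add power2_eq_square)
  then show ?case by simp
next
  case (Suc s)
  have "(r + 2) # replicate (Suc s) 2 = ((r + 2) # replicate s 2) @ [2]"
    by (simp add: replicate_append_same)
  then show ?case
    by (simp only: star_sum_snoc weighted_sum_Suc[of r "Suc s"] Suc)
qed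

section \<open>Passage to the limit\<close>

lemma zeta_star_alt_snoc_sums:
  assumes "\<forall>j\<in>set ks. 1 \<le> j" "2 \<le> k"
  shows "(\<lambda>m. (-1) ^ (m - 1) * (star_sum ks m / real m ^ k)) sums zeta_star_alt (ks @ [k])"
    and "summable (\<lambda>m. norm ((-1) ^ (m - 1) * (star_sum ks m / real m ^ k)))"
proof -
  let ?f = "\<lambda>m. (-1) ^ (m - 1) * (star_sum ks m / real m ^ k)"
  show abs: "summable (\<lambda>m. norm (?f m))"
    using summable_star_sum_div_power[OF assms] by (simp add: abs_mult power_abs star_sum_nonneg)
  then have sums: "?f sums suminf ?f" by (rule summable_sums[OF summable_norm_cancel])
  have "(\<lambda>N. \<Sum>m=1..N. ?f m) \<longlonglongrightarrow> suminf ?f"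
  proof -
    \<comment> \<open>The term m = 0 is a division by 0^k = 0 and hence 0.\<close>
    have "(\<Sum>m\<le>N. ?f m) = (\<Sum>m=1..N. ?f m)" for N
      using assms by (intro sum.mono_neutral_right) (auto simp: Suc_le_eq)
    with sums show ?thesis by (simp add: sums_def_le)
  qed
  then have "zeta_star_alt (ks @ [k]) = suminf ?f"
    unfolding zeta_star_alt_def star_sum_alt_snoc by (rule limI)
  with sums show "?f sums zeta_star_alt (ks @ [k])" by simp
qed

theorem mainTheorem4:
  fixes r s :: nat
  assumes "s \<ge> 1"
  shows "zeta_star ((r + 2) # replicate (s - 1) 2) =
    (\<Sum>i=0..r. (-1) ^ (r - i) * 2 ^ (i + 1) *
       (\<Sum>ks\<in>compositions (i + 1) (r + 1).
          zeta_star_alt (butlast ks @ [last ks + (2 * s - 1)])))"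
proof -
  define f where "f = (\<lambda>ks m. (-1) ^ (m - 1) * (star_sum (butlast ks) m / real m ^ (last ks + (2 * s - 1))))"
  \<comment> \<open>\<open>b n\<close> gathers all right-hand terms whose largest variable is
    n.\<close>
  define b where "b = (\<lambda>n. \<Sum>i=0..r. (-1) ^ (r - i) * 2 ^ (i + 1) * (\<Sum>ks\<in>compositions (i + 1) (r + 1). f ks n))"
  have f: "f ks sums zeta_star_alt (butlast ks @ [last ks + (2 * s - 1)])"
          "summable (\<lambda>n. norm (f ks n))"
    if "ks \<in> compositions (i + 1) (r + 1)" for i ks
  proof -
    from that obtain ks' k where ks: "ks = ks' @ [k]" "\<forall>j\<in>set ks'. 1 \<le> j" "1 \<le> k"
      by (auto elim: composition_SucE)
    with assms zeta_star_alt_snoc_sums[of ks' "k + (2 * s - 1)"]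
    show "f ks sums zeta_star_alt (butlast ks @ [last ks + (2 * s - 1)])"
      "summable (\<lambda>n. norm (f ks n))" unfolding f_def by simp_all
  qed
  have b_sums: "b sums (\<Sum>i=0..r. (-1) ^ (r - i) * 2 ^ (i + 1) *
       (\<Sum>ks\<in>compositions (i + 1) (r + 1). zeta_star_alt (butlast ks @ [last ks + (2 * s - 1)])))"
    unfolding b_def by (intro sums_sum sums_mult f)
  \<comment> \<open>Absolute summability makes the norm of \<open>b\<close> the dominating sequence
    for Tannery's theorem.\<close>
  have abs_b: "summable (\<lambda>n. norm (b n))"
  proof (rule summable_comparison_test')
    show "summable (\<lambda>n. \<Sum>i=0..r. 2 ^ (i + 1) * (\<Sum>ks\<in>compositions (i + 1) (r + 1). norm (f ks n)))"
      by (intro summable_sum summable_mult f)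
    show "norm (norm (b n)) \<le> (\<Sum>i=0..r. 2 ^ (i + 1) * (\<Sum>ks\<in>compositions (i + 1) (r + 1). norm (f ks n)))"
      for n
      unfolding b_def real_norm_def abs_abs
      by (intro order.trans[OF sum_abs] sum_mono)
         (auto simp: abs_mult power_abs intro!: mult_left_mono sum_abs)
  qed
  have b_eq: "b n = (-1) ^ (n - 1) * real n * star_incr r n / real n ^ (2 * s)" if "1 \<le> n" for n
  proof -
    have "real n ^ (2 * s) = real n * real n ^ (2 * s - 1)"
      using assms by (simp flip: power_Suc)
    then have "(-1) ^ (n - 1) * real n * star_incr r n / real n ^ (2 * s) =
        (-1) ^ (n - 1) / real n ^ (2 * s - 1) * star_incr r n"
      using that by simp
    also have "\<dots> = b n"
      unfolding b_def star_incr_def f_def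
      by (simp add: sum_distrib_left power_add mult_ac)
    finally show ?thesis by simp
  qed
  have "star_sum ((r + 2) # replicate (s - 1) 2) N = (\<Sum>n. binom_weight N n * b n)" for N
  proof -
    \<comment> \<open>The series starts at 0; since s \<ge> 1, the exponent is positive and the
      quotient is again a division by 0.\<close>
    have b0: "b 0 = 0"
    proof -
      have "f ks 0 = 0" for ks
        using assms by (simp add: f_def power_0_left)
      then show ?thesis by (simp add: b_def)
    qed
    \<comment> \<open>Weights vanish beyond \<open>N\<close>, so the truncation becomes a full
      series in which only the weights depend on \<open>N\<close>.\<close>
    have "(\<Sum>n. binom_weight N n * b n) = (\<Sum>n\<in>{1..N}. binom_weight N n * b n)"
      by (rule suminf_finite) (auto simp: b0 not_le binom_weight_eq_0 Suc_le_eq)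
    also have "\<dots> = weighted_sum r s N"
      unfolding weighted_sum_def by (intro sum.cong refl) (simp add: b_eq mult_ac)
    finally show ?thesis
      using star_sum_eq_weighted_sum[of r "s - 1" N] assms by simp
  qed
  moreover have "(\<lambda>N. \<Sum>n. binom_weight N n * b n) \<longlonglongrightarrow> suminf b"
  proof -
    have lim: "(\<lambda>N. binom_weight N n * b n) \<longlonglongrightarrow> b n" for n
      using tendsto_mult_right[OF binom_weight_tendsto_1] by simp
    have "norm (binom_weight N n * b n) \<le> norm (b n)" for N n
      using binom_weight_bounds[of N n] by (simp add: abs_mult mult_left_le_one_le)
    then have "\<forall>\<^sub>F (n, N) in sequentially \<times>\<^sub>F sequentially. norm (binom_weight N n * b n) \<le> norm (b n)"
      by (intro always_eventually) auto
    from tannerys_theorem[OF lim this abs_b sequentially_bot] show ?thesis by blast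
  qed
  ultimately have "(\<lambda>N. star_sum ((r + 2) # replicate (s - 1) 2) N) \<longlonglongrightarrow> suminf b" by simp
  then have "zeta_star ((r + 2) # replicate (s - 1) 2) = suminf b"
    unfolding zeta_star_def star_sum_def by (rule limI)
  with sums_unique[OF b_sums] show ?thesis by simp
qed

end
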